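(* Let $R$ be a commutative ring with unity and $Y\subseteq\mathrm{Spec}(R)$. Then the following statements are equivalent: (a) Every ideal of $R$ is a strong $\mathcal{H}_Y$-ideal. (b) Every finitely generated ideal of $R$ is a strong $\mathcal{H}_Y$-ideal. (c) Every finitely generated ideal of $R$ is a $Y$-Hilbert ideal. (d) Every ideal of $R$ is an $\mathcal{H}_Y$-ideal. (e) Every principal ideal of $R$ is an $\mathcal{H}_Y$-ideal. (f) Every principal ideal of $R$ is a strong $\mathcal{H}_Y$-ideal. (g) Every principal ideal of $R$ is a $Y$-Hilbert ideal. (h) $k(Y)=\langle 0\rangle$ and $R$ is a (von Neumann) regular ring. (k) $k(Y)=\langle 0\rangle$ and every essential ideal of $R$ is a strong $\mathcal{H}_Y$-ideal. (l) $k(Y)=\langle 0\rangle$ and every essential ideal of $R$ is an $\mathcal{H}_Y$-ideal.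
   Context: $h_Y(S)=\{P\in Y: S\subseteq P\}$ for $S\subseteq R$, $h_Y(a)=h_Y(\{a\})$, and for $X\subseteq Y$, $k(X)=\bigcap_{P\in X}P$ (with $k(\emptyset)=R$); $kh_Y(S)=k(h_Y(S))$. An ideal $I$ of $R$ (not necessarily proper) is an $\mathcal{H}_Y$-ideal if $a\in I$, $b\in R$ and $h_Y(a)\subseteq h_Y(b)$ imply $b\in I$. It is a strong $\mathcal{H}_Y$-ideal if for every finite subset $F\subseteq I$ and every $b\in R$, $h_Y(F)\subseteq h_Y(b)$ implies $b\in I$. It is a $Y$-Hilbert ideal if $I=kh_Y(I)$. $R$ is regular if for every $a\in R$ there is $b\in R$ with $a=a^2b$. *)

theory Defs
  imports "HOL-Algebra.Ideal"
begin

definition spec :: "('a, 'm) ring_scheme \<Rightarrow> 'a set set"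
  where "spec R = {P. primeideal P R}"

definition hull_in :: "'a set set \<Rightarrow> 'a set \<Rightarrow> 'a set set"
  where "hull_in Y S = {P \<in> Y. S \<subseteq> P}"

text \<open>The intersection of the members of \<open>X\<close>, taken inside the carrier so that the empty
  intersection is the whole ring.\<close>

definition kernel_of :: "('a, 'm) ring_scheme \<Rightarrow> 'a set set \<Rightarrow> 'a set"
  where "kernel_of R X = {x \<in> carrier R. \<forall>P\<in>X. x \<in> P}"

definition H_ideal :: "('a, 'm) ring_scheme \<Rightarrow> 'a set set \<Rightarrow> 'a set \<Rightarrow> bool"
  where "H_ideal R Y I \<longleftrightarrow> ideal I R \<and>
    (\<forall>a\<in>I. \<forall>b\<in>carrier R. hull_in Y {a} \<subseteq> hull_in Y {b} \<longrightarrow> b \<in> I)"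

definition strong_H_ideal :: "('a, 'm) ring_scheme \<Rightarrow> 'a set set \<Rightarrow> 'a set \<Rightarrow> bool"
  where "strong_H_ideal R Y I \<longleftrightarrow> ideal I R \<and>
    (\<forall>F b. finite F \<and> F \<subseteq> I \<and> b \<in> carrier R \<and> hull_in Y F \<subseteq> hull_in Y {b} \<longrightarrow> b \<in> I)"

definition Hilbert_ideal :: "('a, 'm) ring_scheme \<Rightarrow> 'a set set \<Rightarrow> 'a set \<Rightarrow> bool"
  where "Hilbert_ideal R Y I \<longleftrightarrow> ideal I R \<and> I = kernel_of R (hull_in Y I)"

definition fin_gen_ideal :: "'a set \<Rightarrow> ('a, 'm) ring_scheme \<Rightarrow> bool"
  where "fin_gen_ideal I R \<longleftrightarrow> (\<exists>F. finite F \<and> F \<subseteq> carrier R \<and> I = Idl\<^bsub>R\<^esub> F)"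

definition essential_ideal :: "'a set \<Rightarrow> ('a, 'm) ring_scheme \<Rightarrow> bool"
  where "essential_ideal I R \<longleftrightarrow> ideal I R \<and>
    (\<forall>J. ideal J R \<and> J \<noteq> {\<zero>\<^bsub>R\<^esub>} \<longrightarrow> I \<inter> J \<noteq> {\<zero>\<^bsub>R\<^esub>})"

definition regular_ring :: "('a, 'm) ring_scheme \<Rightarrow> bool"
  where "regular_ring R \<longleftrightarrow> ring R \<and>
    (\<forall>a\<in>carrier R. \<exists>b\<in>carrier R. a = a [^]\<^bsub>R\<^esub> (2::nat) \<otimes>\<^bsub>R\<^esub> b)"

definition all_equivalent :: "bool list \<Rightarrow> bool"
  where "all_equivalent ps \<longleftrightarrow> (\<forall>p\<in>set ps. \<forall>q\<in>set ps. p \<longleftrightarrow> q)"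

end

theory Submission
  imports Defs
begin

text \<open>Condition (h) is the hub. If \<open>R\<close> is regular, a finite subset \<open>F\<close> of an ideal \<open>I\<close> is absorbed by
  an idempotent \<open>e \<in> I\<close>; if moreover \<open>h\<^sub>Y(F) \<subseteq> h\<^sub>Y(b)\<close>, then \<open>(1 - e) b\<close> lies in every member of
  \<open>Y\<close>, so \<open>b = e b \<in> I\<close> once \<open>k(Y) = 0\<close>. Conversely \<open>a\<close> and \<open>a\<^sup>2\<close> have the same hull, so
  \<open>a \<in> a\<^sup>2 R\<close> as soon as \<open>a\<^sup>2 R\<close> is an \<open>H\<^sub>Y\<close>-ideal. If only essential ideals are known to be
  \<open>H\<^sub>Y\<close>-ideals, one uses the ideal \<open>(a\<^sup>3 R : a)\<close> instead, which contains \<open>a\<^sup>2\<close> and is essential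
  because \<open>k(Y) = 0\<close> makes \<open>R\<close> reduced.\<close>

text \<open>Suits an argument with a hub: each condition is compared once with a fixed
  \<open>q\<close> instead of with every other condition.\<close>

lemma all_equivalentI:
  assumes "list_all (\<lambda>p. p \<longleftrightarrow> q) ps"
  shows "all_equivalent ps"
  using assms unfolding all_equivalent_def list_all_iff by blast

section \<open>Comparison of strong, plain and Hilbert ideals\<close>

lemma strong_H_ideal_imp_H_ideal:
  assumes "strong_H_ideal R Y I"
  shows "H_ideal R Y I"
  unfolding H_ideal_def
proof (intro conjI ballI impI)
  show "ideal I R"
    using assms by (simp add: strong_H_ideal_def)
  fix a b assume "a \<in> I" "b \<in> carrier R" "hull_in Y {a} \<subseteq> hull_in Y {b}"
  moreover have "finite {a}" by simp
  ultimately show "b \<in> I"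
    using assms unfolding strong_H_ideal_def by (metis empty_subsetI insert_subset)
qed

lemma Hilbert_ideal_imp_H_ideal:
  assumes "Hilbert_ideal R Y I"
  shows "H_ideal R Y I"
  unfolding H_ideal_def
proof (intro conjI ballI impI)
  show "ideal I R"
    using assms by (simp add: Hilbert_ideal_def)
  fix a b assume "a \<in> I" "b \<in> carrier R" "hull_in Y {a} \<subseteq> hull_in Y {b}"
  \<comment> \<open>A member of \<open>Y\<close> that contains \<open>I\<close> contains
    \<open>a\<close>, hence \<open>b\<close>.\<close>
  then have "b \<in> kernel_of R (hull_in Y I)"
    by (auto simp: kernel_of_def hull_in_def)
  then show "b \<in> I"
    using assms by (simp add: Hilbert_ideal_def)
qed

lemma principalideal_imp_fin_gen_ideal:
  assumes "principalideal I R"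
  shows "fin_gen_ideal I R"
proof -
  obtain i where "i \<in> carrier R" "I = Idl\<^bsub>R\<^esub> {i}"
    using principalideal.generate[OF assms] by blast
  then show ?thesis
    unfolding fin_gen_ideal_def by (intro exI[of _ "{i}"]) simp
qed

context cring
begin

lemma hull_in_genideal:
  assumes "Y \<subseteq> spec R" "S \<subseteq> carrier R"
  shows "hull_in Y (Idl S) = hull_in Y S"
proof -
  have "Idl S \<subseteq> P \<longleftrightarrow> S \<subseteq> P" if "P \<in> Y" for P
  proof -
    have "ideal P R"
      using assms(1) that by (auto simp: spec_def primeideal_def)
    then show ?thesis
      using genideal_minimal genideal_self[OF assms(2)] by blast
  qed
  then show ?thesis
    by (auto simp: hull_in_def)
qed

text \<open>A finite generating set \<open>F\<close> has the same hull as \<open>I\<close>, so the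
  strong condition, tested on \<open>F\<close> alone, already captures the whole of
  \<open>kernel_of R (hull_in Y I)\<close>.\<close>

lemma fin_gen_strong_H_ideal_imp_Hilbert_ideal:
  assumes "Y \<subseteq> spec R" "fin_gen_ideal I R" "strong_H_ideal R Y I"
  shows "Hilbert_ideal R Y I"
proof -
  obtain F where F: "finite F" "F \<subseteq> carrier R" "I = Idl F"
    using assms(2) by (auto simp: fin_gen_ideal_def)
  have I: "ideal I R"
    using assms(3) by (simp add: strong_H_ideal_def)
  have "b \<in> I" if b: "b \<in> kernel_of R (hull_in Y I)" for b
  proof -
    have "b \<in> carrier R" "hull_in Y F \<subseteq> hull_in Y {b}"
      using b hull_in_genideal[OF assms(1) F(2)] F(3) by (auto simp: kernel_of_def hull_in_def)
    moreover have "F \<subseteq> I"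
      using genideal_self[OF F(2)] F(3) by simp
    ultimately show ?thesis
      using assms(3) F(1) unfolding strong_H_ideal_def by blast
  qed
  moreover have "I \<subseteq> kernel_of R (hull_in Y I)"
    using ideal.Icarr[OF I] by (auto simp: kernel_of_def hull_in_def)
  ultimately show ?thesis
    using I unfolding Hilbert_ideal_def by blast
qed

section \<open>The kernel of \<open>Y\<close> and reducedness\<close>

text \<open>Every member of \<open>Y\<close> contains zero, so the hull of zero is all of
  \<open>Y\<close>, and the condition at zero speaks of exactly the elements common to all members
  of \<open>Y\<close>.\<close>

lemma kernel_of_eq_zero_iff_H_ideal:
  assumes "Y \<subseteq> spec R"
  shows "kernel_of R Y = {\<zero>} \<longleftrightarrow> H_ideal R Y {\<zero>}"
proof -
  have zero: "\<zero> \<in> P" if "P \<in> Y" for P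
    using assms that
    by (auto simp: spec_def primeideal_def intro: additive_subgroup.zero_closed ideal.axioms(1))
  then have "hull_in Y {\<zero>} \<subseteq> hull_in Y {b} \<longleftrightarrow> (\<forall>P\<in>Y. b \<in> P)" for b
    by (auto simp: hull_in_def)
  then show ?thesis
    using zero zeroideal by (auto simp: H_ideal_def kernel_of_def)
qed

lemma hull_in_square:
  assumes "Y \<subseteq> spec R" "a \<in> carrier R"
  shows "hull_in Y {a \<otimes> a} \<subseteq> hull_in Y {a}"
  using assms primeideal.I_prime by (fastforce simp: hull_in_def spec_def)

text \<open>The hull of \<open>x \<otimes> x\<close>, that is of zero, lies in the hull of
  \<open>x\<close>, and the zero ideal is an \<open>H_ideal\<close>.\<close>

lemma reduced_if_kernel_of_eq_zero:
  assumes "Y \<subseteq> spec R" "kernel_of R Y = {\<zero>}" "x \<in> carrier R" "x \<otimes> x = \<zero>"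
  shows "x = \<zero>"
  using assms hull_in_square[OF assms(1,3)]
  unfolding kernel_of_eq_zero_iff_H_ideal[OF assms(1)] H_ideal_def by auto

section \<open>Idempotents in regular rings\<close>

lemma regular_ring_iff:
  "regular_ring R \<longleftrightarrow> (\<forall>a\<in>carrier R. \<exists>b\<in>carrier R. a = a \<otimes> a \<otimes> b)"
  by (simp add: regular_ring_def ring_axioms numeral_2_eq_2)

text \<open>Induction on \<open>F\<close>. The new element \<open>f\<close> is absorbed by the
  idempotent \<open>g = f \<otimes> b\<close>, and the join of \<open>e\<close> and \<open>g\<close>
  among idempotents absorbs whatever either of them absorbs.\<close>

lemma regular_ring_idempotent_absorbing_finite_set:
  assumes "regular_ring R" "ideal I R" "finite F" "F \<subseteq> I"
  shows "\<exists>e\<in>I. e \<otimes> e = e \<and> (\<forall>f\<in>F. f = f \<otimes> e)"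
  using assms(3,4)
proof (induction F)
  case empty
  have "\<zero> \<in> I"
    using assms(2) by (simp add: additive_subgroup.zero_closed ideal.axioms(1))
  then show ?case
    by (intro bexI[of _ \<zero>]) auto
next
  case (insert f F)
  interpret ideal I R by fact
  obtain e where e: "e \<in> I" "e \<otimes> e = e" "\<forall>f\<in>F. f = f \<otimes> e"
    using insert by auto
  have f: "f \<in> I" "f \<in> carrier R"
    using insert.prems by auto
  then obtain b where b: "b \<in> carrier R" "f = f \<otimes> f \<otimes> b"
    using assms(1) unfolding regular_ring_iff by blast
  define g where "g = f \<otimes> b"
  have g: "g \<in> I"
    using f b by (simp add: g_def I_r_closed)
  have ec: "e \<in> carrier R" and gc: "g \<in> carrier R"
    using e(1) g by auto
  have fg: "f \<otimes> g = f"
    using b f by (simp add: g_def m_assoc)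
  have gg: "g \<otimes> g = g"
  proof -
    \<comment> \<open>Regrouping isolates the factor \<open>f \<otimes> g\<close>, which is
      \<open>f\<close>.\<close>
    have "g \<otimes> g = (f \<otimes> g) \<otimes> b"
      using f(2) b(1) by (simp add: g_def m_ac)
    then show ?thesis
      unfolding fg by (simp add: g_def)
  qed
  \<comment> \<open>\<open>1 - h = (1 - e) (1 - g)\<close>\<close>
  define h where "h = e \<oplus> (g \<ominus> e \<otimes> g)"
  have hc: "h \<in> carrier R"
    using ec gc by (simp add: h_def)
  have h: "h \<in> I"
    unfolding h_def minus_eq
    using e(1) g ec gc by (intro a_closed a_inv_closed I_r_closed) auto
  have eh: "e \<otimes> h = e"
  proof -
    have "e \<otimes> h = e \<otimes> e \<oplus> (e \<otimes> g \<ominus> e \<otimes> e \<otimes> g)"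
      unfolding h_def using ec gc by algebra
    then show ?thesis
      using e(2) ec gc by (simp add: minus_eq r_neg)
  qed
  have gh: "g \<otimes> h = g"
  proof -
    have "g \<otimes> h = e \<otimes> g \<oplus> (g \<otimes> g \<ominus> e \<otimes> (g \<otimes> g))"
      unfolding h_def using ec gc by algebra
    also have "\<dots> = g"
      unfolding gg using ec gc by algebra
    finally show ?thesis .
  qed
  \<comment> \<open>Only the left factor is expanded; replacing \<open>e \<otimes> h\<close> by
    \<open>e\<close> and \<open>g \<otimes> h\<close> by \<open>g\<close> then restores the
    definition of \<open>h\<close>.\<close>
  have "h \<otimes> h = e \<otimes> h \<oplus> (g \<otimes> h \<ominus> e \<otimes> (g \<otimes> h))"
    unfolding h_def using ec gc by algebra
  then have "h \<otimes> h = h"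
    by (simp add: eh gh) (simp add: h_def)
  moreover have "x = x \<otimes> h" if "x \<in> F" for x
  proof -
    have "x \<in> carrier R" "x = x \<otimes> e"
      using that insert.prems e(3) by auto
    then show ?thesis
      using m_assoc[OF _ ec hc] eh by metis
  qed
  moreover have "f = f \<otimes> h"
    using fg gh f gc hc by (metis m_assoc)
  ultimately show ?case
    using h by blast
qed

lemma regular_ring_strong_H_ideal:
  assumes "Y \<subseteq> spec R" "kernel_of R Y = {\<zero>}" "regular_ring R" "ideal I R"
  shows "strong_H_ideal R Y I"
  unfolding strong_H_ideal_def
proof (intro conjI allI impI)
  show "ideal I R" by fact
  interpret ideal I R by fact
  fix F b
  assume "finite F \<and> F \<subseteq> I \<and> b \<in> carrier R \<and> hull_in Y F \<subseteq> hull_in Y {b}"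
  then have F: "finite F" "F \<subseteq> I" and b: "b \<in> carrier R" and hull: "hull_in Y F \<subseteq> hull_in Y {b}"
    by auto
  obtain e where e: "e \<in> I" "e \<otimes> e = e" "\<forall>f\<in>F. f = f \<otimes> e"
    using regular_ring_idempotent_absorbing_finite_set[OF assms(3,4) F] by auto
  have ec: "e \<in> carrier R"
    using e(1) by auto
  \<comment> \<open>The product of \<open>e\<close> and \<open>\<one> \<ominus> e\<close> is zero,
    so the prime \<open>P\<close> contains one of them. If it contains \<open>e\<close>, it contains
    every \<open>f = f \<otimes> e\<close> in \<open>F\<close>, and the hull condition puts
    \<open>b\<close> into \<open>P\<close>.\<close>
  have "(\<one> \<ominus> e) \<otimes> b \<in> P" if "P \<in> Y" for P
  proof -
    interpret P: primeideal P R
      using that assms(1) by (auto simp: spec_def)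
    have "e \<otimes> (\<one> \<ominus> e) = e \<ominus> e \<otimes> e"
      using ec by algebra
    then have "e \<otimes> (\<one> \<ominus> e) \<in> P"
      using e(2) ec by (simp add: minus_eq r_neg)
    then consider "e \<in> P" | "\<one> \<ominus> e \<in> P"
      using P.I_prime ec by (meson minus_closed one_closed)
    then show ?thesis
    proof cases
      case 1
      have "F \<subseteq> P"
      proof
        fix f assume "f \<in> F"
        then have "f \<in> carrier R" "f = f \<otimes> e"
          using F(2) e(3) by auto
        then show "f \<in> P"
          using P.I_l_closed[OF 1] by metis
      qed
      then have "b \<in> P"
        using hull that by (auto simp: hull_in_def)
      then show ?thesis
        using ec by (simp add: P.I_l_closed)
    next
      case 2
      then show ?thesis
        using b by (simp add: P.I_r_closed)
    qed
  qed
  then have "(\<one> \<ominus> e) \<otimes> b \<in> kernel_of R Y"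
    using ec b by (simp add: kernel_of_def)
  then have "(\<one> \<ominus> e) \<otimes> b = \<zero>"
    using assms(2) by simp
  moreover have "b = e \<otimes> b \<oplus> (\<one> \<ominus> e) \<otimes> b"
    using ec b by algebra
  ultimately have "b = e \<otimes> b"
    using ec b by simp
  then show "b \<in> I"
    using I_r_closed[OF e(1) b] by simp
qed

section \<open>Regularity from principal or essential ideals\<close>

lemma regular_ring_if_principal_H_ideals:
  assumes "Y \<subseteq> spec R" and H: "\<And>I. principalideal I R \<Longrightarrow> H_ideal R Y I"
  shows "kernel_of R Y = {\<zero>} \<and> regular_ring R"
proof
  show "kernel_of R Y = {\<zero>}"
    \<comment> \<open>The zero ideal is principal, so the hypothesis covers it.\<close>
    using H[OF zeropideal] kernel_of_eq_zero_iff_H_ideal[OF assms(1)] by simp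
  show "regular_ring R"
    unfolding regular_ring_iff
  proof
    fix a assume a: "a \<in> carrier R"
    have "principalideal (PIdl (a \<otimes> a)) R"
      using a by (simp add: cgenideal_is_principalideal)
    then have "H_ideal R Y (PIdl (a \<otimes> a))"
      by (rule H)
    moreover have "a \<otimes> a \<in> PIdl (a \<otimes> a)"
      using a by (simp add: cgenideal_self)
    ultimately have "a \<in> PIdl (a \<otimes> a)"
      using a hull_in_square[OF assms(1) a] unfolding H_ideal_def by blast
    then obtain b where "b \<in> carrier R" "a = b \<otimes> (a \<otimes> a)"
      by (auto simp: cgenideal_def)
    then show "\<exists>b\<in>carrier R. a = a \<otimes> a \<otimes> b"
      using a m_comm m_closed by metis
  qed
qed

text \<open>This is the colon ideal \<open>(c R : a)\<close>; it is used below with \<open>c\<close>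
  the cube of \<open>a\<close>.\<close>

lemma ideal_colon_principal:
  assumes "a \<in> carrier R" "c \<in> carrier R"
  shows "ideal {x \<in> carrier R. \<exists>r\<in>carrier R. a \<otimes> x = c \<otimes> r} R" (is "ideal ?I R")
proof (rule idealI[OF ring_axioms])
  show "subgroup ?I (add_monoid R)"
  proof (rule add.subgroupI)
    show "?I \<noteq> {}"
      using assms by (auto intro!: exI[of _ \<zero>] bexI[of _ \<zero>])
  next
    fix x assume "x \<in> ?I"
    then obtain r where "x \<in> carrier R" "r \<in> carrier R" "a \<otimes> x = c \<otimes> r"
      by auto
    then show "\<ominus> x \<in> ?I"
      using assms by (auto simp: r_minus intro!: bexI[of _ "\<ominus> r"])
  next
    fix x y assume "x \<in> ?I" "y \<in> ?I"
    then obtain r s where "x \<in> carrier R" "r \<in> carrier R" "a \<otimes> x = c \<otimes> r"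
      and "y \<in> carrier R" "s \<in> carrier R" "a \<otimes> y = c \<otimes> s"
      by auto
    then show "x \<oplus> y \<in> ?I"
      using assms by (auto simp: r_distr intro!: bexI[of _ "r \<oplus> s"])
  qed auto
next
  fix x z assume "x \<in> ?I" and z: "z \<in> carrier R"
  then obtain r where "x \<in> carrier R" "r \<in> carrier R" "a \<otimes> x = c \<otimes> r"
    by auto
  then have "a \<otimes> (x \<otimes> z) = c \<otimes> (r \<otimes> z)"
    using assms z by (metis m_assoc)
  then show "x \<otimes> z \<in> ?I"
    using \<open>x \<in> carrier R\<close> \<open>r \<in> carrier R\<close> z by blast
  then show "z \<otimes> x \<in> ?I"
    using \<open>x \<in> carrier R\<close> z by (simp add: m_comm)
qed

text \<open>The cube is chosen because \<open>(a^2 R : a)\<close> contains \<open>a\<close>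
  trivially, which yields no information. Membership of \<open>a\<close> in
  \<open>(a^3 R : a)\<close> says that \<open>a^2\<close> is a multiple of \<open>a^3\<close>, and
  reducedness then cancels one factor \<open>a\<close>.\<close>

lemma regular_ring_if_essential_H_ideals:
  assumes "Y \<subseteq> spec R" "kernel_of R Y = {\<zero>}"
    and H: "\<And>I. essential_ideal I R \<Longrightarrow> H_ideal R Y I"
  shows "regular_ring R"
  unfolding regular_ring_iff
proof
  fix a assume a: "a \<in> carrier R"
  note reduced = reduced_if_kernel_of_eq_zero[OF assms(1,2)]
  define I where "I = {x \<in> carrier R. \<exists>r\<in>carrier R. a \<otimes> x = a \<otimes> a \<otimes> a \<otimes> r}"
  have I: "ideal I R"
    unfolding I_def using a by (intro ideal_colon_principal) auto
  have aaI: "a \<otimes> a \<in> I"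
    using a by (auto simp: I_def m_assoc intro!: bexI[of _ \<one>])
  have "I \<inter> J \<noteq> {\<zero>}" if J: "ideal J R" and "J \<noteq> {\<zero>}" for J
  proof -
    interpret J: ideal J R by fact
    obtain x where x: "x \<in> J" "x \<noteq> \<zero>"
      using \<open>J \<noteq> {\<zero>}\<close> J.zero_closed by blast
    have xc: "x \<in> carrier R"
      using x(1) by auto
    show ?thesis
    \<comment> \<open>If \<open>a \<otimes> x\<close> vanishes, \<open>x\<close> itself is a common
      nonzero element. Otherwise \<open>a \<otimes> a \<otimes> x\<close> is one: were it zero, the
      square of \<open>a \<otimes> x\<close> would be zero too.\<close>
    proof (cases "a \<otimes> x = \<zero>")
      case True
      then have "x \<in> I"
        using a xc by (auto simp: I_def intro!: bexI[of _ \<zero>])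
      then show ?thesis
        using x by blast
    next
      case False
      have "a \<otimes> a \<otimes> x \<noteq> \<zero>"
      proof
        assume *: "a \<otimes> a \<otimes> x = \<zero>"
        have "(a \<otimes> x) \<otimes> (a \<otimes> x) = (a \<otimes> a \<otimes> x) \<otimes> x"
          using a xc by algebra
        then have "(a \<otimes> x) \<otimes> (a \<otimes> x) = \<zero>"
          using * xc by simp
        then have "a \<otimes> x = \<zero>"
          by (rule reduced[rotated]) (use a xc in simp)
        then show False
          using False by simp
      qed
      moreover have "a \<otimes> a \<otimes> x \<in> I \<inter> J"
        using a xc x(1) aaI I by (simp add: J.I_l_closed ideal.I_r_closed)
      ultimately show ?thesis
        by blast
    qed
  qed
  then have "H_ideal R Y I"
    using I H by (simp add: essential_ideal_def)
  then have "a \<in> I"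
    using aaI a hull_in_square[OF assms(1) a] unfolding H_ideal_def by blast
  then obtain r where r: "r \<in> carrier R" "a \<otimes> a = a \<otimes> a \<otimes> a \<otimes> r"
    by (auto simp: I_def)
  \<comment> \<open>The defect of the desired equation. It is killed by \<open>a\<close> and is also
    the multiple \<open>a \<otimes> (\<one> \<ominus> a \<otimes> r)\<close> of \<open>a\<close>, so
    its square is zero.\<close>
  define u where "u = a \<ominus> a \<otimes> a \<otimes> r"
  have uc: "u \<in> carrier R"
    using a r by (simp add: u_def)
  have "a \<otimes> u = a \<otimes> a \<ominus> a \<otimes> a \<otimes> a \<otimes> r"
    unfolding u_def using a r(1) by algebra
  also have "\<dots> = \<zero>"
    using a r by (simp add: r(2)[symmetric] minus_eq r_neg)
  finally have au: "a \<otimes> u = \<zero>" .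
  have "u \<otimes> u = (a \<otimes> u) \<otimes> (\<one> \<ominus> a \<otimes> r)"
    unfolding u_def using a r(1) by algebra
  then have "u \<otimes> u = \<zero>"
    using au a r by simp
  then have "u = \<zero>"
    using uc by (rule reduced[rotated])
  then have "a = a \<otimes> a \<otimes> r"
    using a r(1) minus_equality minus_minus unfolding u_def minus_eq by (metis m_closed a_inv_closed)
  then show "\<exists>b\<in>carrier R. a = a \<otimes> a \<otimes> b"
    using r(1) by blast
qed

end

theorem proposition5p8:
  fixes R :: "('a, 'm) ring_scheme" and Y :: "'a set set"
  assumes "cring R" and "Y \<subseteq> spec R"
  shows "all_equivalent
    [\<forall>I. ideal I R \<longrightarrow> strong_H_ideal R Y I,
     \<forall>I. fin_gen_ideal I R \<longrightarrow> strong_H_ideal R Y I,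
     \<forall>I. fin_gen_ideal I R \<longrightarrow> Hilbert_ideal R Y I,
     \<forall>I. ideal I R \<longrightarrow> H_ideal R Y I,
     \<forall>I. principalideal I R \<longrightarrow> H_ideal R Y I,
     \<forall>I. principalideal I R \<longrightarrow> strong_H_ideal R Y I,
     \<forall>I. principalideal I R \<longrightarrow> Hilbert_ideal R Y I,
     kernel_of R Y = {\<zero>\<^bsub>R\<^esub>} \<and> regular_ring R,
     kernel_of R Y = {\<zero>\<^bsub>R\<^esub>} \<and> (\<forall>I. essential_ideal I R \<longrightarrow> strong_H_ideal R Y I),
     kernel_of R Y = {\<zero>\<^bsub>R\<^esub>} \<and> (\<forall>I. essential_ideal I R \<longrightarrow> H_ideal R Y I)]"
proof -
  interpret cring R by fact
  let ?h = "kernel_of R Y = {\<zero>\<^bsub>R\<^esub>} \<and> regular_ring R"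
  have fg: "ideal I R" if "fin_gen_ideal I R" for I
    using that genideal_ideal by (auto simp: fin_gen_ideal_def)
  note pr = principalideal_imp_fin_gen_ideal and sH = strong_H_ideal_imp_H_ideal
    and hH = Hilbert_ideal_imp_H_ideal
    and sh = fin_gen_strong_H_ideal_imp_Hilbert_ideal[OF assms(2)]
  have h_imp: "strong_H_ideal R Y I" if ?h "ideal I R" for I
    using that regular_ring_strong_H_ideal[OF assms(2)] by blast
  have h_ess: "strong_H_ideal R Y I" if ?h "essential_ideal I R" for I
    using that h_imp by (simp add: essential_ideal_def)
  \<comment> \<open>This hypothesis is (e), the weakest of (a) to (g): each of the others implies it
    directly.\<close>
  have imp_h: ?h if "\<forall>I. principalideal I R \<longrightarrow> H_ideal R Y I"
    using that regular_ring_if_principal_H_ideals[OF assms(2)] by blast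
  \<comment> \<open>The condition on the kernel cannot be derived from essential ideals: over a
    field with \<open>Y\<close> empty, the only essential ideal is the whole field, while the kernel
    of \<open>Y\<close> is not zero.\<close>
  have ess: ?h if "kernel_of R Y = {\<zero>\<^bsub>R\<^esub>}" "\<forall>I. essential_ideal I R \<longrightarrow> H_ideal R Y I"
    using that regular_ring_if_essential_H_ideals[OF assms(2)] by blast
  have "(\<forall>I. ideal I R \<longrightarrow> strong_H_ideal R Y I) \<longleftrightarrow> ?h"
    using h_imp imp_h pr fg sH by blast
  moreover have "(\<forall>I. fin_gen_ideal I R \<longrightarrow> strong_H_ideal R Y I) \<longleftrightarrow> ?h"
    using h_imp imp_h pr fg sH by blast
  moreover have "(\<forall>I. fin_gen_ideal I R \<longrightarrow> Hilbert_ideal R Y I) \<longleftrightarrow> ?h"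
    using h_imp imp_h pr fg hH sh by blast
  moreover have "(\<forall>I. ideal I R \<longrightarrow> H_ideal R Y I) \<longleftrightarrow> ?h"
    using h_imp imp_h pr fg sH by blast
  moreover have "(\<forall>I. principalideal I R \<longrightarrow> H_ideal R Y I) \<longleftrightarrow> ?h"
    using h_imp imp_h pr fg sH by blast
  moreover have "(\<forall>I. principalideal I R \<longrightarrow> strong_H_ideal R Y I) \<longleftrightarrow> ?h"
    using h_imp imp_h pr fg sH by blast
  moreover have "(\<forall>I. principalideal I R \<longrightarrow> Hilbert_ideal R Y I) \<longleftrightarrow> ?h"
    using h_imp imp_h pr fg hH sh by blast
  moreover have "(kernel_of R Y = {\<zero>\<^bsub>R\<^esub>} \<and> (\<forall>I. essential_ideal I R \<longrightarrow> strong_H_ideal R Y I)) \<longleftrightarrow> ?h"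
    using h_ess ess sH by blast
  moreover have "(kernel_of R Y = {\<zero>\<^bsub>R\<^esub>} \<and> (\<forall>I. essential_ideal I R \<longrightarrow> H_ideal R Y I)) \<longleftrightarrow> ?h"
    using h_ess ess sH by blast
  ultimately show ?thesis
    by - (rule all_equivalentI[where q = ?h], unfold list.pred_inject(2),
        intro conjI list.pred_inject(1) refl)
qed

end
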